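(* Let $\Lambda \subset \mathbb{R}^n$ be an $n$-dimensional lattice containing the origin $\mathbf{0}$, let $P = V_{\Lambda}(\mathbf{0})$ be the Voronoi cell of $\mathbf{0}$ with respect to $\Lambda$, and let $R = R(\Lambda)$ be the covering radius of $\Lambda$. Then the equality $$\int_{P} \| x \|^2 \, dx = \frac{R^2}{3} \cdot |P|$$ holds if and only if $P$ is a rectangular box, i.e. a direct Minkowski sum of $n$ pairwise orthogonal segments.
   Context: $\|\cdot\|$ is the standard Euclidean norm on $\mathbb{R}^n$, $|X|$ is the $n$-dimensional Lebesgue measure of $X \subset \mathbb{R}^n$, and $\operatorname{dist}(x,\Lambda)$ is the Euclidean distance from the point $x$ to the set $\Lambda$. An $n$-dimensional lattice containing the origin is a discrete additive subgroup of $\mathbb{R}^n$ of full rank $n$. The covering radius of $\Lambda$ is $R(\Lambda) = \sup_{x \in \mathbb{R}^n} \operatorname{dist}(x, \Lambda)$. For $v \in \Lambda$, the Voronoi cell of $v$ with respect to $\Lambda$ is $V_{\Lambda}(v) = \{ x \in \mathbb{R}^n : \| x - v \| = \operatorname{dist}(x, \Lambda) \}$. The segments in the definition of a rectangular box are nondegenerate and their directions are pairwise orthogonal but need not be parallel to the coordinate axes. *)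

theory Defs
  imports "HOL-Analysis.Analysis"
begin

(* The rank of a discrete subgroup is the dimension of its real span,
   so full rank means that the real span is the whole space. *)
definition full_rank_lattice :: "(real ^ 'n) set \<Rightarrow> bool" where
  "full_rank_lattice \<Lambda> \<longleftrightarrow>
     0 \<in> \<Lambda> \<and> (\<forall>x\<in>\<Lambda>. \<forall>y\<in>\<Lambda>. x + y \<in> \<Lambda>) \<and> (\<forall>x\<in>\<Lambda>. - x \<in> \<Lambda>) \<and>
     discrete \<Lambda> \<and> span \<Lambda> = UNIV"

definition covering_radius :: "(real ^ 'n) set \<Rightarrow> real" where
  "covering_radius \<Lambda> = (SUP x. infdist x \<Lambda>)"

definition voronoi_cell :: "(real ^ 'n) set \<Rightarrow> real ^ 'n \<Rightarrow> (real ^ 'n) set" where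
  "voronoi_cell \<Lambda> v = {x. norm (x - v) = infdist x \<Lambda>}"

(* Sums of sets are Minkowski sums (HOL-Library.Set_Algebras). Nonzero pairwise
   orthogonal directions are linearly independent, so the sum is automatically direct. *)
definition rectangular_box :: "(real ^ 'n) set \<Rightarrow> bool" where
  "rectangular_box P \<longleftrightarrow>
     (\<exists>a b :: 'n \<Rightarrow> real ^ 'n.
        (\<forall>i. a i \<noteq> b i) \<and>
        (\<forall>i j. i \<noteq> j \<longrightarrow> orthogonal (b i - a i) (b j - a j)) \<and>
        P = (\<Sum>i\<in>UNIV. closed_segment (a i) (b i)))"

end

(* Write f(x) = dist(x, L)^2. If u, w are lattice points nearest to x and p - x, the parallelogram
   law for a = x - u and b = p - x - w gives
     2 f(x) + 2 f(p - x) = |a + b|^2 + |a - b|^2 >= f(p) + f(2x - p),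
   since a + b and a - b represent p and 2x - p modulo L. The maps x -> p - x and x -> 2x - p
   preserve the uniform measure on the torus, so averaging yields 3 * avg f >= f(p), and for
   f(p) = R^2 equality holds iff the inequality above is an equality for every x.

   Assume this. Every x with 2x - p in L then has f(x) = R^2/4, and this shows that for a Voronoi
   relevant vector v (one such that only v and -v are shortest in v + 2L) and a point s of p + L
   of norm R, one of s + v, s - v has norm R too. So 2<s,v> = |v|^2 up to sign, for all such s
   and v, and comparing two relevant vectors along s and s +- v shows that they are orthogonal or
   equal up to sign. As the relevant vectors span the space and cut out the Voronoi cell, the cell
   is a box.

   Conversely, if the cell is a box with half-axes h_i, then every 2 h_i is a lattice vector, so
   the corners sum(+- h_i) are congruent modulo L. Choosing the corner s in the orthant of x, the
   points x, s - x and 2x - s all lie in the cell, so the inequality for p = s is the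
   parallelogram law itself. *)

theory Submission
  imports Defs
begin

lemma norm_le_norm_diff_iff:
  fixes x v :: "'a::real_inner"
  shows "norm x \<le> norm (x - v) \<longleftrightarrow> 2 * (x \<bullet> v) \<le> v \<bullet> v"
  by (simp add: norm_le inner_diff inner_commute)

subsection \<open>Lattices and their Voronoi cells\<close>

locale full_lattice =
  fixes L :: "(real ^ 'n) set"
  assumes full_rank: "full_rank_lattice L"
begin

abbreviation cell :: "(real ^ 'n) set" where
  "cell \<equiv> voronoi_cell L 0"

lemma zero_mem [simp]: "0 \<in> L"
  and add_mem: "x \<in> L \<Longrightarrow> y \<in> L \<Longrightarrow> x + y \<in> L"
  and uminus_mem: "x \<in> L \<Longrightarrow> - x \<in> L"
  and span_eq_UNIV: "span L = UNIV"
  using full_rank by (auto simp: full_rank_lattice_def)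

lemma diff_mem: "x \<in> L \<Longrightarrow> y \<in> L \<Longrightarrow> x - y \<in> L"
  using add_mem[of x "- y"] uminus_mem by simp

lemma nonempty [simp]: "L \<noteq> {}"
  using zero_mem by blast

lemma scale_nat_mem: "x \<in> L \<Longrightarrow> real k *\<^sub>R x \<in> L"
  by (induction k) (auto simp: algebra_simps intro: add_mem)

lemma scale_int_mem: "x \<in> L \<Longrightarrow> real_of_int k *\<^sub>R x \<in> L"
  using scale_nat_mem[of x "nat k"] uminus_mem[OF scale_nat_mem[of x "nat (- k)"]]
  by (cases "k \<ge> 0") auto

lemma sum_mem: "(\<And>i. i \<in> I \<Longrightarrow> g i \<in> L) \<Longrightarrow> sum g I \<in> L"
  by (induction I rule: infinite_finite_induct) (auto intro: add_mem)

text \<open>Translation by lattice vectors carries the isolation of 0 to every lattice point, with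
  the same radius.\<close>

lemma uniform_discrete_lattice: "uniform_discrete L"
proof -
  have "0 isolated_in L"
    using full_rank by (auto simp: full_rank_lattice_def intro: discreteD)
  then obtain d where d: "d > 0" "\<And>y. y \<in> L \<Longrightarrow> dist 0 y < d \<Longrightarrow> y = 0"
    by (elim isolated_inE_dist) blast
  show ?thesis
  proof (rule uniformI1[OF d(1)])
    fix x y assume "x \<in> L" "y \<in> L" "dist x y < d"
    then show "x = y"
      using d(2)[of "y - x"] diff_mem by (simp add: dist_norm norm_minus_commute)
  qed
qed

lemma closed_lattice: "closed L"
  by (rule uniform_discrete_imp_closed[OF uniform_discrete_lattice])

lemma finite_lattice_cball: "finite (L \<inter> cball x r)"
  using uniform_discrete_finite_iff[of "L \<inter> cball x r"]
  by (metis Int_lower1 Int_lower2 bounded_cball bounded_subset uniform_discrete_subset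
      uniform_discrete_lattice)

lemma countable_lattice: "countable L"
proof -
  have "L = (\<Union>k::nat. L \<inter> cball 0 (real k))"
    using real_arch_simple by (auto simp: mem_cball dist_norm)
  moreover have "countable (\<Union>k::nat. L \<inter> cball 0 (real k))"
    by (intro countable_UN countableI_type countable_finite finite_lattice_cball)
  ultimately show ?thesis
    by simp
qed

lemma infdist_le_norm_diff: "v \<in> L \<Longrightarrow> infdist x L \<le> norm (x - v)"
  using infdist_le[of v L x] by (simp add: dist_norm)

lemma infdist_attained:
  obtains v where "v \<in> L" "infdist x L = norm (x - v)"
  using infdist_attains_inf[OF closed_lattice nonempty, of x] by (auto simp: dist_norm)

lemma mem_cell_iff: "x \<in> cell \<longleftrightarrow> (\<forall>v\<in>L. norm x \<le> norm (x - v))"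
proof
  assume "x \<in> cell"
  then show "\<forall>v\<in>L. norm x \<le> norm (x - v)"
    by (auto simp: voronoi_cell_def infdist_le_norm_diff)
next
  assume *: "\<forall>v\<in>L. norm x \<le> norm (x - v)"
  obtain v where "v \<in> L" "infdist x L = norm (x - v)"
    by (rule infdist_attained)
  then show "x \<in> cell"
    using * infdist_le_norm_diff[OF zero_mem, of x] by (force simp: voronoi_cell_def)
qed

lemma mem_cell_iff_inner: "x \<in> cell \<longleftrightarrow> (\<forall>v\<in>L. 2 * (x \<bullet> v) \<le> v \<bullet> v)"
  by (simp add: mem_cell_iff norm_le_norm_diff_iff)

lemma infdist_cell: "x \<in> cell \<Longrightarrow> infdist x L = norm x"
  by (simp add: voronoi_cell_def)

lemma infdist_add_lattice [simp]:
  assumes "v \<in> L"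
  shows "infdist (x + v) L = infdist x L"
proof -
  have "infdist (x + v) L \<le> infdist x L" if "v \<in> L" for x v
  proof -
    obtain w where "w \<in> L" "infdist x L = norm (x - w)"
      by (rule infdist_attained)
    then show ?thesis
      using infdist_le_norm_diff[OF add_mem[OF \<open>w \<in> L\<close> that], of "x + v"] by simp
  qed
  from this[OF assms, of x] this[OF uminus_mem[OF assms], of "x + v"] show ?thesis
    by simp
qed

lemma infdist_diff_lattice [simp]: "v \<in> L \<Longrightarrow> infdist (x - v) L = infdist x L"
  using infdist_add_lattice[of "- v" x] uminus_mem by simp

lemma infdist_cong_lattice: "x - y \<in> L \<Longrightarrow> infdist x L = infdist y L"
  using infdist_diff_lattice[of "x - y" x] by simp

lemma infdist_uminus [simp]: "infdist (- x) L = infdist x L"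
proof -
  have "infdist (- x) L \<le> infdist x L" for x
  proof -
    obtain w where "w \<in> L" "infdist x L = norm (x - w)"
      by (rule infdist_attained)
    then show ?thesis
      using infdist_le_norm_diff[OF uminus_mem[OF \<open>w \<in> L\<close>], of "- x"]
      by (simp add: norm_minus_commute)
  qed
  from this[of x] this[of "- x"] show ?thesis
    by simp
qed

lemma infdist_commute: "infdist (x - y) L = infdist (y - x) L"
  by (metis infdist_uminus minus_diff_eq)

text \<open>Subtracting a nearest lattice point works. Statements about periodic functions thereby
  reduce to points of the cell.\<close>

lemma cell_reduction:
  obtains v where "v \<in> L" "x - v \<in> cell"
proof -
  obtain v where v: "v \<in> L" "infdist x L = norm (x - v)"
    by (rule infdist_attained)
  then have "x - v \<in> cell"
    by (simp add: voronoi_cell_def)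
  show thesis
    by (rule that[OF v(1) \<open>x - v \<in> cell\<close>])
qed

lemma uminus_mem_cell_iff [simp]: "- x \<in> cell \<longleftrightarrow> x \<in> cell"
  by (simp add: voronoi_cell_def)

lemma closed_cell: "closed cell"
proof -
  have "closed {x. norm x = infdist x L}"
    by (intro closed_Collect_eq continuous_intros)
  then show ?thesis
    by (simp add: voronoi_cell_def)
qed

text \<open>\<open>B\<close> is a basis of the space chosen inside \<open>L\<close>, not necessarily
  a lattice basis. Rounding the coordinates of \<open>x\<close> down gives a lattice point, and the
  remaining coefficients lie between 0 and 1. The bound makes the supremum in
  \<open>covering_radius\<close> a genuine one.\<close>

lemma infdist_bounded: "\<exists>K. \<forall>x. infdist x L \<le> K"
proof -
  obtain B where B: "B \<subseteq> L" "independent B" "L \<subseteq> span B"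
    using maximal_independent_subset by blast
  have finB: "finite B"
    using B(2) by (rule independent_imp_finite)
  have spanB: "span B = UNIV"
    using span_minimal[OF B(3) subspace_span] by (simp add: span_eq_UNIV top.extremum_unique)
  have "infdist x L \<le> (\<Sum>b\<in>B. norm b)" for x
  proof -
    have "x \<in> range (\<lambda>c. \<Sum>b\<in>B. c b *\<^sub>R b)"
      using spanB span_finite[OF finB] by simp
    then obtain c where x: "x = (\<Sum>b\<in>B. c b *\<^sub>R b)"
      by blast
    define v where "v = (\<Sum>b\<in>B. real_of_int \<lfloor>c b\<rfloor> *\<^sub>R b)"
    have "v \<in> L"
      unfolding v_def using B(1) by (intro sum_mem scale_int_mem) auto
    then have "infdist x L \<le> norm (x - v)"
      by (rule infdist_le_norm_diff)
    also have "x - v = (\<Sum>b\<in>B. frac (c b) *\<^sub>R b)"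
      by (simp add: x v_def frac_def algebra_simps sum_subtractf)
    also have "norm \<dots> \<le> (\<Sum>b\<in>B. norm b)"
      by (intro sum_norm_le)
        (auto simp: frac_ge_0 frac_lt_1 intro!: mult_left_le_one_le frac_lt_1[THEN less_imp_le])
    finally show ?thesis .
  qed
  then show ?thesis by blast
qed

section \<open>Compactness of the cell, its interior and its farthest points\<close>

lemma compact_cell: "compact cell"
proof -
  obtain K where "\<forall>x. infdist x L \<le> K"
    using infdist_bounded by blast
  then have "cell \<subseteq> cball 0 K"
    by (auto simp: voronoi_cell_def)
  then show ?thesis
    using closed_cell by (auto simp: compact_eq_bounded_closed intro: bounded_subset)
qed

text \<open>Half the separation of the lattice is a suitable radius: for
  \<open>v \<noteq> 0\<close>, \<open>norm (x - v)\<close> is at least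
  \<open>norm v - norm x\<close>, which exceeds \<open>norm x\<close>.\<close>

lemma cell_contains_ball: "\<exists>r>0. ball 0 r \<subseteq> cell"
proof -
  obtain e where e: "e > 0" "\<And>x y. x \<in> L \<Longrightarrow> y \<in> L \<Longrightarrow> dist x y < e \<Longrightarrow> x = y"
    using uniform_discrete_lattice by (auto simp: uniform_discrete_def)
  have "x \<in> cell" if "norm x < e / 2" for x
    unfolding mem_cell_iff
  proof
    fix v assume "v \<in> L"
    show "norm x \<le> norm (x - v)"
    proof (cases "v = 0")
      case False
      then have "e \<le> norm v"
        using e(2)[OF \<open>v \<in> L\<close> zero_mem] by force
      then show ?thesis
        using that norm_triangle_ineq2[of v x] by (simp add: norm_minus_commute)
    qed simp
  qed
  then show ?thesis
    using e(1) by (intro exI[of _ "e / 2"]) auto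
qed

lemma zero_mem_cell: "0 \<in> cell"
  by (simp add: mem_cell_iff)

lemma infdist_le_covering_radius: "infdist x L \<le> covering_radius L"
  unfolding covering_radius_def
  using infdist_bounded by (intro cSUP_upper) (auto simp: bdd_above_def)

text \<open>The norm has a maximum on the compact cell, and every point is congruent to one of the
  cell, where norm and distance agree.\<close>

lemma covering_radius_attained:
  obtains p where "p \<in> cell" "norm p = covering_radius L"
proof -
  obtain p where p: "p \<in> cell" "\<And>x. x \<in> cell \<Longrightarrow> norm x \<le> norm p"
    using continuous_attains_sup[OF compact_cell, of norm] zero_mem_cell
    by (auto intro: continuous_on_norm_id)
  have "infdist x L \<le> norm p" for x
  proof -
    obtain v where v: "v \<in> L" "x - v \<in> cell"
      by (rule cell_reduction)
    then show ?thesis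
      using p(2)[OF v(2)] infdist_cell[OF v(2)] by simp
  qed
  then have "covering_radius L \<le> norm p"
    unfolding covering_radius_def by (intro cSUP_least) auto
  moreover have "norm p \<le> covering_radius L"
    using infdist_le_covering_radius[of p] infdist_cell[OF p(1)] by simp
  ultimately show thesis
    using that p(1) by force
qed

end

subsection \<open>Integrals of periodic functions over the Voronoi cell\<close>

lemma nn_integral_lborel_affine:
  fixes t :: "'a::euclidean_space" and c :: real
  assumes [measurable]: "h \<in> borel_measurable borel" and c: "c \<noteq> 0"
  shows "(\<integral>\<^sup>+x. h x \<partial>lborel) = ennreal (\<bar>c\<bar> ^ DIM('a)) * (\<integral>\<^sup>+x. h (t + c *\<^sub>R x) \<partial>lborel)"
  by (subst lborel_affine[OF c, of t])
    (simp add: nn_integral_density nn_integral_distr nn_integral_cmult)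

lemma AE_not_in_hyperplane:
  fixes a :: "'a::euclidean_space"
  assumes "a \<noteq> 0"
  shows "AE x in lborel. a \<bullet> x \<noteq> b"
proof (rule AE_I')
  have "{x. a \<bullet> x = b} \<in> null_sets (completion lborel)"
    using negligible_hyperplane[of a b] assms by (simp add: negligible_iff_null_sets)
  then show "{x. a \<bullet> x = b} \<in> null_sets lborel"
    using null_sets_completion_iff[of "{x. a \<bullet> x = b}" lborel] closed_hyperplane[of a b] by simp
qed auto

context full_lattice
begin

text \<open>A tie between two distinct translates puts \<open>x\<close> on a hyperplane, and
  countably many hyperplanes form a null set. This disposes of overlaps along cell boundaries in the
  counts below.\<close>

lemma AE_distinct_norms:
  "AE x in lborel. \<forall>v\<in>L. \<forall>w\<in>L. v \<noteq> w \<longrightarrow> norm (x - c + v) \<noteq> norm (x - c + w)"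
proof -
  have "AE x in lborel. v \<noteq> w \<longrightarrow> norm (x - c + v) \<noteq> norm (x - c + w)" for v w
  proof (cases "v = w")
    case False
    then have "AE x in lborel. (v - w) \<bullet> x \<noteq> (v - w) \<bullet> c + (w \<bullet> w - v \<bullet> v) / 2"
      by (intro AE_not_in_hyperplane) simp
    then show ?thesis
    proof eventually_elim
      case (elim x)
      have "norm (x - c + v) = norm (x - c + w) \<longleftrightarrow> (x - c + v) \<bullet> (x - c + v) = (x - c + w) \<bullet> (x - c + w)"
        by (simp add: norm_eq)
      also have "\<dots> \<longleftrightarrow> (v - w) \<bullet> x = (v - w) \<bullet> c + (w \<bullet> w - v \<bullet> v) / 2"
        by (simp add: inner_diff inner_add inner_commute field_simps)
      finally show ?case
        using elim by simp
    qed
  qed simp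
  then show ?thesis
    by (simp add: AE_ball_countable countable_lattice)
qed

section \<open>The index of \<open>k L\<close> in \<open>L\<close> and translates of the dilated
  cell\<close>

definition coset :: "nat \<Rightarrow> real ^ 'n \<Rightarrow> (real ^ 'n) set" where
  "coset k v = (\<lambda>w. v + real k *\<^sub>R w) ` L"

text \<open>Measured by counting, so that an infinite quotient would have index \<open>\<infinity>\<close>;
  \<open>L\<close> modulo \<open>k L\<close> is seen to have \<open>k ^ n\<close> elements only inside \<open>nn_integral_cell_dilate\<close>.\<close>

definition index :: "nat \<Rightarrow> ennreal" where
  "index k = emeasure (count_space (coset k ` L)) (coset k ` L)"

lemma coset_eq_iff:
  assumes "k > 0"
  shows "coset k v = coset k v' \<longleftrightarrow> (\<exists>w\<in>L. v' = v + real k *\<^sub>R w)"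
proof
  assume "coset k v = coset k v'"
  moreover have "v' \<in> coset k v'"
    unfolding coset_def by (rule image_eqI[of _ _ 0]) auto
  ultimately show "\<exists>w\<in>L. v' = v + real k *\<^sub>R w"
    by (auto simp: coset_def)
next
  assume "\<exists>w\<in>L. v' = v + real k *\<^sub>R w"
  then obtain w where w: "w \<in> L" "v' = v + real k *\<^sub>R w" ..
  show "coset k v = coset k v'"
  proof (intro equalityI subsetI)
    fix x assume "x \<in> coset k v"
    then obtain u where "u \<in> L" "x = v + real k *\<^sub>R u"
      by (auto simp: coset_def)
    then show "x \<in> coset k v'"
      unfolding coset_def using w by (intro image_eqI[of _ _ "u - w"]) (auto simp: diff_mem algebra_simps)
  next
    fix x assume "x \<in> coset k v'"
    then obtain u where "u \<in> L" "x = v' + real k *\<^sub>R u"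
      by (auto simp: coset_def)
    then show "x \<in> coset k v"
      unfolding coset_def using w by (intro image_eqI[of _ _ "w + u"]) (auto simp: add_mem algebra_simps)
  qed
qed

text \<open>With this value, \<open>AE_count_translates\<close> at \<open>k = 1\<close> says that
  the cell tiles the space up to a null set.\<close>

lemma index_1 [simp]: "index (Suc 0) = 1"
proof -
  have "coset 1 v = coset 1 0" if "v \<in> L" for v
  proof -
    have "0 = v + real 1 *\<^sub>R (- v)"
      by simp
    then show ?thesis
      using coset_eq_iff[OF zero_less_one] uminus_mem[OF that] by blast
  qed
  then have "coset 1 ` L = {coset 1 0}"
    using zero_mem by blast
  then show ?thesis
    by (simp add: index_def)
qed

text \<open>The cell dilated by \<open>k\<close> is the Voronoi cell of \<open>k L\<close>. Hence
  each class of \<open>L\<close> modulo \<open>k L\<close> contributes a vector \<open>v\<close>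
  making \<open>x - c + v\<close> shortest in the class; off a null set it is unique.\<close>

lemma AE_count_translates:
  assumes k: "k > 0"
  shows "AE x in lborel.
    (\<integral>\<^sup>+v. indicator cell ((x + v - c) /\<^sub>R real k) \<partial>count_space L) = index k"
  using AE_distinct_norms[of c]
proof eventually_elim
  case (elim x)
  define A where "A = {v \<in> L. (x + v - c) /\<^sub>R real k \<in> cell}"
  have "bij_betw (coset k) A (coset k ` L)"
    unfolding bij_betw_def
  proof (intro conjI inj_onI equalityI subsetI)
    fix v v' assume v: "v \<in> A" "v' \<in> A" "coset k v = coset k v'"
    then obtain w where w: "w \<in> L" "v' = v + real k *\<^sub>R w"
      using coset_eq_iff[OF k] by blast
    have le: "norm (x - c + v) \<le> norm (x - c + (v + real k *\<^sub>R w))"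
      if "v \<in> A" "w \<in> L" for v w
    proof -
      have "(x + v - c) /\<^sub>R real k \<in> cell" "- w \<in> L"
        using that uminus_mem by (auto simp: A_def)
      then have "norm ((x + v - c) /\<^sub>R real k) \<le> norm ((x + v - c) /\<^sub>R real k - (- w))"
        by (auto simp only: mem_cell_iff)
      then have "real k * norm ((x + v - c) /\<^sub>R real k) \<le> real k * norm ((x + v - c) /\<^sub>R real k - (- w))"
        by (rule mult_left_mono) simp
      also have "\<dots> = norm (real k *\<^sub>R ((x + v - c) /\<^sub>R real k - (- w)))"
        by simp
      also have "real k *\<^sub>R ((x + v - c) /\<^sub>R real k - (- w)) = x - c + (v + real k *\<^sub>R w)"
        using k by (simp add: algebra_simps)
      also have "real k * norm ((x + v - c) /\<^sub>R real k) = norm (x + v - c)"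
        using k by simp
      also have "x + v - c = x - c + v"
        by simp
      finally show ?thesis .
    qed
    \<comment> \<open>Each of the two is shortest in the common class, so the norms tie, which the
      choice of \<open>x\<close> excludes for distinct vectors.\<close>
    have "norm (x - c + v) = norm (x - c + v')"
      using le[OF v(1) w(1)] le[OF v(2) uminus_mem[OF w(1)]] w(2) by simp
    then show "v = v'"
      using elim v(1,2) by (auto simp: A_def)
  next
    fix C assume "C \<in> coset k ` L"
    then obtain v where v: "v \<in> L" "C = coset k v"
      by blast
    obtain w where w: "w \<in> L" "(x + v - c) /\<^sub>R real k - w \<in> cell"
      by (rule cell_reduction)
    have "(x + (v + real k *\<^sub>R (- w)) - c) /\<^sub>R real k = (x + v - c) /\<^sub>R real k - w"
      using k by (simp add: algebra_simps)
    then have "v + real k *\<^sub>R (- w) \<in> A"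
      using v(1) w scale_nat_mem[of "- w" k] uminus_mem unfolding A_def
      by (metis (no_types, lifting) add_mem mem_Collect_eq)
    moreover have "C = coset k (v + real k *\<^sub>R (- w))"
      using coset_eq_iff[OF k] uminus_mem[OF w(1)] v(2) by blast
    ultimately show "C \<in> coset k ` A"
      by blast
  qed (auto simp: A_def)
  \<comment> \<open>Finiteness is carried along because \<open>card\<close> is 0 on infinite sets,
    where the counting measure is infinite.\<close>
  then have "card A = card (coset k ` L)" "finite A \<longleftrightarrow> finite (coset k ` L)"
    by (auto simp: bij_betw_same_card bij_betw_finite)
  moreover have "(\<integral>\<^sup>+v. indicator cell ((x + v - c) /\<^sub>R real k) \<partial>count_space L)
      = (\<integral>\<^sup>+v. indicator A v \<partial>count_space L)"
    by (intro nn_integral_cong) (auto simp: A_def indicator_def)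
  moreover have "(\<integral>\<^sup>+v. indicator A v \<partial>count_space L) = emeasure (count_space L) A"
    by (rule nn_integral_indicator) (auto simp: A_def)
  moreover have "A \<subseteq> L"
    by (auto simp: A_def)
  ultimately show ?case
    by (simp add: index_def emeasure_count_space)
qed

lemma nn_integral_count_uminus:
  "(\<integral>\<^sup>+v. F (- v) \<partial>count_space L) = (\<integral>\<^sup>+v. F v \<partial>count_space L)"
proof (rule nn_integral_bij_count_space)
  show "bij_betw uminus L L"
    by (rule bij_betw_byWitness[of _ uminus]) (auto intro: uminus_mem)
qed

lemma cell_measurable [measurable]: "cell \<in> sets borel"
  using closed_cell by simp

text \<open>Unfolding: insert the number 1 of cell translates containing \<open>x\<close>, exchange
  sum and integral, and shift each summand back to the cell. The translates of \<open>w\<close> then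
  add up to \<open>N\<close>.\<close>

lemma nn_integral_periodic_unfold:
  fixes w g :: "real ^ 'n \<Rightarrow> ennreal"
  assumes [measurable]: "w \<in> borel_measurable borel" "g \<in> borel_measurable borel"
    and periodic: "\<And>x v. v \<in> L \<Longrightarrow> g (x + v) = g x"
    and count: "AE x in lborel. (\<integral>\<^sup>+v. w (x + v) \<partial>count_space L) = N"
  shows "(\<integral>\<^sup>+x. w x * g x \<partial>lborel) = N * (\<integral>\<^sup>+x. g x * indicator cell x \<partial>lborel)"
proof -
  have "(\<integral>\<^sup>+x. w x * g x \<partial>lborel)
      = (\<integral>\<^sup>+x. \<integral>\<^sup>+v. w x * g x * indicator cell (x - v) \<partial>count_space L \<partial>lborel)"
  proof (rule nn_integral_cong_AE)
    show "AE x in lborel. w x * g x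
        = (\<integral>\<^sup>+v. w x * g x * indicator cell (x - v) \<partial>count_space L)"
      using AE_count_translates[OF zero_less_one, of 0]
    proof eventually_elim
      case (elim x)
      then show ?case
        using nn_integral_count_uminus[of "\<lambda>v. indicator cell (x + v)"]
        by (simp add: nn_integral_cmult)
    qed
  qed
  also have "\<dots> = (\<integral>\<^sup>+v. \<integral>\<^sup>+x. w x * g x * indicator cell (x - v) \<partial>lborel \<partial>count_space L)"
    by (rule nn_integral_count_space_nn_integral) (auto simp: countable_lattice)
  \<comment> \<open>Replacing \<open>x\<close> by \<open>x + v\<close> moves the translation from
    the cell to \<open>w\<close>; \<open>g\<close> is unchanged by periodicity.\<close>
  also have "\<dots> = (\<integral>\<^sup>+v. \<integral>\<^sup>+x. w (x + v) * (g x * indicator cell x) \<partial>lborel \<partial>count_space L)"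
  proof (rule nn_integral_cong)
    fix v assume v: "v \<in> space (count_space L)"
    show "(\<integral>\<^sup>+x. w x * g x * indicator cell (x - v) \<partial>lborel)
        = (\<integral>\<^sup>+x. w (x + v) * (g x * indicator cell x) \<partial>lborel)"
      by (subst nn_integral_lborel_affine[where c = 1 and t = v])
        (use v periodic in \<open>auto simp: add.commute[of v] mult.assoc\<close>)
  qed
  also have "\<dots> = (\<integral>\<^sup>+x. \<integral>\<^sup>+v. w (x + v) * (g x * indicator cell x) \<partial>count_space L \<partial>lborel)"
    by (rule nn_integral_count_space_nn_integral[symmetric]) (auto simp: countable_lattice)
  also have "\<dots> = (\<integral>\<^sup>+x. N * (g x * indicator cell x) \<partial>lborel)"
  proof (rule nn_integral_cong_AE)
    show "AE x in lborel. (\<integral>\<^sup>+v. w (x + v) * (g x * indicator cell x) \<partial>count_space L)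
        = N * (g x * indicator cell x)"
      using count by eventually_elim (simp add: nn_integral_multc)
  qed
  also have "\<dots> = N * (\<integral>\<^sup>+x. g x * indicator cell x \<partial>lborel)"
    by (rule nn_integral_cmult) simp
  finally show ?thesis .
qed

lemma emeasure_cell_finite: "emeasure lborel cell < \<infinity>"
  using emeasure_bounded_finite compact_imp_bounded[OF compact_cell] by blast

lemma emeasure_cell_pos: "emeasure lborel cell > 0"
proof -
  obtain r where r: "r > 0" "ball 0 r \<subseteq> cell"
    using cell_contains_ball by blast
  have "0 < emeasure lborel (ball (0::real ^ 'n) r)"
    using content_ball_pos[OF r(1), of "0::real ^ 'n"] emeasure_lborel_ball_finite[of "0::real ^ 'n" r]
    by (simp add: emeasure_eq_ennreal_measure)
  also have "\<dots> \<le> emeasure lborel cell"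
    using r(2) by (intro emeasure_mono) auto
  finally show ?thesis .
qed

text \<open>The map \<open>c + k x\<close> preserves averages over the torus. The integral over the
  dilated cell is computed twice: substitution gives the factor \<open>K\<close>, unfolding the
  factor \<open>index k\<close>.\<close>

lemma nn_integral_cell_dilate:
  fixes g :: "real ^ 'n \<Rightarrow> ennreal"
  assumes k: "k > 0"
    and [measurable]: "g \<in> borel_measurable borel"
    and periodic: "\<And>x v. v \<in> L \<Longrightarrow> g (x + v) = g x"
  shows "(\<integral>\<^sup>+x. g (c + real k *\<^sub>R x) * indicator cell x \<partial>lborel)
       = (\<integral>\<^sup>+x. g x * indicator cell x \<partial>lborel)"
proof -
  define K where "K = ennreal (\<bar>real k\<bar> ^ DIM(real ^ 'n))"
  have eq: "K * (\<integral>\<^sup>+x. h (c + real k *\<^sub>R x) * indicator cell x \<partial>lborel)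
      = index k * (\<integral>\<^sup>+x. h x * indicator cell x \<partial>lborel)"
    if [measurable]: "h \<in> borel_measurable borel" and "\<And>x v. v \<in> L \<Longrightarrow> h (x + v) = h x"
    for h :: "real ^ 'n \<Rightarrow> ennreal"
  proof -
    have "(\<integral>\<^sup>+x. indicator cell ((x - c) /\<^sub>R real k) * h x \<partial>lborel)
        = K * (\<integral>\<^sup>+x. indicator cell ((c + real k *\<^sub>R x - c) /\<^sub>R real k) * h (c + real k *\<^sub>R x) \<partial>lborel)"
      unfolding K_def using k by (intro nn_integral_lborel_affine) auto
    also have "\<dots> = K * (\<integral>\<^sup>+x. h (c + real k *\<^sub>R x) * indicator cell x \<partial>lborel)"
      using k by (simp add: mult.commute)
    finally show ?thesis
      using nn_integral_periodic_unfold[of "\<lambda>x. indicator cell ((x - c) /\<^sub>R real k)" h "index k"]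
        AE_count_translates[OF k, of c] that(2) by simp
  qed
  \<comment> \<open>The constant function determines the index without any basis of the lattice.\<close>
  have "K * emeasure lborel cell = index k * emeasure lborel cell"
    using eq[of "\<lambda>_. 1"] by simp
  then have "index k = K"
    using emeasure_cell_finite emeasure_cell_pos by (auto simp: mult.commute[of _ \<open>emeasure lborel cell\<close>] ennreal_mult_cancel_left)
  moreover have "K \<noteq> 0" "K \<noteq> top"
    using k by (auto simp: K_def)
  ultimately show ?thesis
    using eq[of g] periodic by (simp add: ennreal_mult_cancel_left)
qed

end

subsection \<open>The parallelogram defect\<close>

context full_lattice
begin

definition defect :: "real ^ 'n \<Rightarrow> real ^ 'n \<Rightarrow> real" where
  "defect p x = 2 * (infdist x L)\<^sup>2 + 2 * (infdist (p - x) L)\<^sup>2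
     - (infdist p L)\<^sup>2 - (infdist (2 *\<^sub>R x - p) L)\<^sup>2"

lemma defect_nonneg: "0 \<le> defect p x"
proof -
  obtain v where v: "v \<in> L" "infdist x L = norm (x - v)"
    by (rule infdist_attained)
  obtain w where w: "w \<in> L" "infdist (p - x) L = norm (p - x - w)"
    by (rule infdist_attained)
  have "infdist p L \<le> norm ((x - v) + (p - x - w))"
    using infdist_le_norm_diff[OF add_mem[OF v(1) w(1)], of p] by (simp add: algebra_simps)
  moreover have "infdist (2 *\<^sub>R x - p) L \<le> norm ((x - v) - (p - x - w))"
    using infdist_le_norm_diff[OF diff_mem[OF v(1) w(1)], of "2 *\<^sub>R x - p"]
    by (simp add: algebra_simps scaleR_2)
  ultimately have "(infdist p L)\<^sup>2 + (infdist (2 *\<^sub>R x - p) L)\<^sup>2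
      \<le> (norm ((x - v) + (p - x - w)))\<^sup>2 + (norm ((x - v) - (p - x - w)))\<^sup>2"
    by (intro add_mono power_mono infdist_nonneg)
  also have "\<dots> = 2 * (norm (x - v))\<^sup>2 + 2 * (norm (p - x - w))\<^sup>2"
    by (simp only: power2_norm_eq_inner inner_add inner_diff inner_commute) algebra
  finally show ?thesis
    unfolding defect_def v(2) w(2) by simp
qed

lemma continuous_on_defect: "continuous_on S (defect p)"
  unfolding defect_def by (intro continuous_intros)

lemma defect_add_lattice:
  assumes "v \<in> L"
  shows "defect p (x + v) = defect p x"
proof -
  have "infdist (p - (x + v)) L = infdist (p - x) L"
    by (rule infdist_cong_lattice) (simp add: assms uminus_mem)
  moreover have "infdist (2 *\<^sub>R (x + v) - p) L = infdist (2 *\<^sub>R x - p) L"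
    by (rule infdist_cong_lattice) (use add_mem[OF assms assms] in \<open>simp add: algebra_simps scaleR_2\<close>)
  ultimately show ?thesis
    by (simp add: defect_def assms)
qed

section \<open>Averaging the defect over the cell\<close>

lemma set_integrable_cell:
  fixes g :: "real ^ 'n \<Rightarrow> real"
  assumes "continuous_on UNIV g"
  shows "set_integrable lborel cell g"
  unfolding set_integrable_def
  by (intro borel_integrable_compact compact_cell continuous_on_subset[OF assms]) simp

lemma set_lebesgue_integral_cell_dilate:
  fixes g :: "real ^ 'n \<Rightarrow> real"
  assumes k: "k > 0" and g: "continuous_on UNIV g" "\<And>x. 0 \<le> g x"
    and periodic: "\<And>x v. v \<in> L \<Longrightarrow> g (x + v) = g x"
  shows "(LINT x:cell|lborel. g (c + real k *\<^sub>R x)) = (LINT x:cell|lborel. g x)"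
proof -
  have [measurable]: "g \<in> borel_measurable borel"
    by (rule borel_measurable_continuous_onI[OF g(1)])
  have eq: "(LINT x:cell|lborel. h x) = enn2real (\<integral>\<^sup>+x. ennreal (h x) * indicator cell x \<partial>lborel)"
    if [measurable]: "h \<in> borel_measurable borel" and "\<And>x. 0 \<le> h x" for h :: "real ^ 'n \<Rightarrow> real"
  proof -
    have "(LINT x:cell|lborel. h x) = enn2real (\<integral>\<^sup>+x. ennreal (indicator cell x *\<^sub>R h x) \<partial>lborel)"
      unfolding set_lebesgue_integral_def
      by (rule integral_eq_nn_integral) (auto simp: that(2))
    also have "(\<integral>\<^sup>+x. ennreal (indicator cell x *\<^sub>R h x) \<partial>lborel)
        = (\<integral>\<^sup>+x. ennreal (h x) * indicator cell x \<partial>lborel)"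
      by (intro nn_integral_cong) (auto simp: indicator_def)
    finally show ?thesis .
  qed
  have "(\<integral>\<^sup>+x. ennreal (g (c + real k *\<^sub>R x)) * indicator cell x \<partial>lborel)
      = (\<integral>\<^sup>+x. ennreal (g x) * indicator cell x \<partial>lborel)"
    by (rule nn_integral_cell_dilate[OF k, of "\<lambda>x. ennreal (g x)"]) (auto simp: periodic)
  then show ?thesis
    using g(2) by (simp add: eq)
qed

text \<open>All three terms depending on \<open>x\<close> have the same average, so their
  coefficients combine to 2 + 2 - 1 = 3.\<close>

lemma integral_cell_defect:
  "(LINT x:cell|lborel. defect p x)
     = 3 * (LINT x:cell|lborel. (infdist x L)\<^sup>2) - (infdist p L)\<^sup>2 * measure lborel cell"
proof -
  let ?f = "\<lambda>x. (infdist x L)\<^sup>2"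
  have f: "continuous_on UNIV ?f" "\<And>x. 0 \<le> ?f x" "\<And>x v. v \<in> L \<Longrightarrow> ?f (x + v) = ?f x"
    by (auto intro!: continuous_intros)
  \<comment> \<open>The distance is even, so the reflection becomes a translation, the case
    \<open>k = 1\<close> of the dilation lemma.\<close>
  have "(LINT x:cell|lborel. ?f (p - x)) = (LINT x:cell|lborel. ?f (- p + real 1 *\<^sub>R x))"
    by (simp add: infdist_commute[of p])
  also have "\<dots> = (LINT x:cell|lborel. ?f x)"
    by (rule set_lebesgue_integral_cell_dilate) (use f in auto)
  finally have 1: "(LINT x:cell|lborel. ?f (p - x)) = (LINT x:cell|lborel. ?f x)" .
  have "(LINT x:cell|lborel. ?f (2 *\<^sub>R x - p)) = (LINT x:cell|lborel. ?f (- p + real 2 *\<^sub>R x))"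
    by simp
  also have "\<dots> = (LINT x:cell|lborel. ?f x)"
    by (rule set_lebesgue_integral_cell_dilate) (use f in auto)
  finally have 2: "(LINT x:cell|lborel. ?f (2 *\<^sub>R x - p)) = (LINT x:cell|lborel. ?f x)" .
  have int: "set_integrable lborel cell (\<lambda>x. 2 * ?f x)"
    "set_integrable lborel cell (\<lambda>x. 2 * ?f (p - x))"
    "set_integrable lborel cell (\<lambda>x. ?f p)"
    "set_integrable lborel cell (\<lambda>x. ?f (2 *\<^sub>R x - p))"
    by (intro set_integrable_cell continuous_intros)+
  have "(LINT x:cell|lborel. ?f p) = ?f p * measure lborel cell"
    unfolding set_lebesgue_integral_def by simp
  then show ?thesis
    unfolding defect_def
    using int 1 2 by (simp add: set_integral_diff set_integral_add)
qed

text \<open>A point \<open>z\<close> of positive defect may lie on the boundary of the cell or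
  outside it. Translating the integrand by \<open>z\<close> preserves the integral and moves the
  positivity to a ball around 0, where the cell has interior.\<close>

lemma integral_cell_defect_eq_0_iff:
  "(LINT x:cell|lborel. defect p x) = 0 \<longleftrightarrow> (\<forall>x. defect p x = 0)"
proof
  assume int0: "(LINT x:cell|lborel. defect p x) = 0"
  show "\<forall>x. defect p x = 0"
  proof (rule ccontr)
    assume "\<not> ?thesis"
    then obtain z where z: "defect p z > 0"
      using defect_nonneg by (metis order_le_less)
    define U where "U = {x. defect p (z + real 1 *\<^sub>R x) > 0}"
    have cont: "continuous_on UNIV (\<lambda>x. defect p (z + real 1 *\<^sub>R x))"
      by (intro continuous_on_compose2[OF continuous_on_defect[of UNIV p]] continuous_intros) auto
    then have "open U" "0 \<in> U"
      using z unfolding U_def by (auto intro!: open_Collect_less continuous_intros)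
    then obtain r where r: "r > 0" "ball 0 r \<subseteq> U"
      by (auto simp: open_contains_ball)
    obtain s where s: "s > 0" "ball 0 s \<subseteq> cell"
      using cell_contains_ball by blast
    have "(LINT x:cell|lborel. defect p (z + real 1 *\<^sub>R x)) = 0"
      unfolding int0[symmetric]
      by (intro set_lebesgue_integral_cell_dilate continuous_on_defect defect_nonneg
          defect_add_lattice) auto
    moreover have "integrable lborel (\<lambda>x. indicator cell x *\<^sub>R defect p (z + real 1 *\<^sub>R x))"
      using set_integrable_cell[OF cont] by (simp add: set_integrable_def)
    ultimately have "AE x in lborel. indicator cell x *\<^sub>R defect p (z + real 1 *\<^sub>R x) = 0"
      unfolding set_lebesgue_integral_def
      by (subst (asm) integral_nonneg_eq_0_iff_AE) (auto simp: defect_nonneg)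
    then have "AE x in lborel. x \<notin> ball (0 :: real ^ 'n) (min r s)"
    proof eventually_elim
      case (elim x)
      then show ?case
        using r(2) s(2) by (force simp: U_def indicator_def split: if_splits)
    qed
    then have "emeasure lborel (ball (0 :: real ^ 'n) (min r s)) = 0"
      using emeasure_eq_0_AE[of "\<lambda>x. x \<in> ball (0 :: real ^ 'n) (min r s)" lborel]
      by (simp only: space_lborel space_borel UNIV_I simp_thms Collect_mem_eq)
    then show False
      using content_ball_pos[of "min r s" "0 :: real ^ 'n"] r(1) s(1)
      by (simp add: measure_def)
  qed
qed (simp add: set_lebesgue_integral_def)

text \<open>On the cell the norm is the distance to \<open>L\<close>. The equivalence is used at a
  farthest point of the cell in one direction and at the corner of a box in the other.\<close>

lemma second_moment_eq_iff:
  assumes "infdist p L = R"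
  shows "(LINT x:cell|lebesgue. (norm x)\<^sup>2) = R\<^sup>2 / 3 * measure lebesgue cell
    \<longleftrightarrow> (\<forall>x. defect p x = 0)"
proof -
  have "(LINT x:cell|lebesgue. (norm x)\<^sup>2) = (LINT x:cell|lborel. (norm x)\<^sup>2)"
    unfolding set_lebesgue_integral_def by (rule integral_completion) simp
  also have "\<dots> = (LINT x:cell|lborel. (infdist x L)\<^sup>2)"
    by (rule set_lebesgue_integral_cong) (auto simp: infdist_cell)
  finally have "(LINT x:cell|lebesgue. (norm x)\<^sup>2) = R\<^sup>2 / 3 * measure lebesgue cell
      \<longleftrightarrow> (LINT x:cell|lborel. defect p x) = 0"
    by (auto simp: integral_cell_defect assms)
  then show ?thesis
    by (simp add: integral_cell_defect_eq_0_iff)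
qed

end

subsection \<open>Orthogonal frames and boxes\<close>

text \<open>The vectors are the half-axes of a box and are not normalised:
  \<open>\<bar>x \<bullet> h i\<bar> \<le> h i \<bullet> h i\<close> says that the coordinate of
  \<open>x\<close> along \<open>h i\<close> lies between -1 and 1.\<close>

locale orthogonal_frame =
  fixes h :: "'n \<Rightarrow> real ^ 'n"
  assumes nonzero: "h i \<noteq> 0"
    and orth: "i \<noteq> j \<Longrightarrow> h i \<bullet> h j = 0"
begin

lemma inner_pos: "h i \<bullet> h i > 0"
  using nonzero by simp

lemma abs_inner_le: "\<bar>h i \<bullet> h j\<bar> \<le> h j \<bullet> h j"
  by (cases "i = j") (auto simp: orth)

lemma sum_inner [simp]: "(\<Sum>i\<in>UNIV. t i *\<^sub>R h i) \<bullet> h j = t j * (h j \<bullet> h j)"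
proof -
  have "(\<Sum>i\<in>UNIV. t i *\<^sub>R h i) \<bullet> h j = (\<Sum>i\<in>UNIV. if i = j then t j * (h j \<bullet> h j) else 0)"
    unfolding inner_sum_left by (intro sum.cong) (auto simp: orth)
  then show ?thesis
    by simp
qed

text \<open>As many nonzero orthogonal vectors as the dimension span the space, so
  \<open>x - y\<close> is orthogonal to itself.\<close>

lemma inner_eqI:
  assumes "\<And>i. x \<bullet> h i = y \<bullet> h i"
  shows "x = y"
proof -
  have inj: "inj h"
    using orth inner_pos by (metis injI order_less_irrefl)
  have "independent (range h)"
    using nonzero orth
    by (intro pairwise_orthogonal_independent) (auto simp: pairwise_def orthogonal_def, metis)
  moreover have "card (range h) = DIM(real ^ 'n)"
    using inj by (simp add: card_image)
  ultimately have "span (range h) = UNIV"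
    by (metis card_eq_dim dim_UNIV finite_class.finite_UNIV finite_imageI order_refl subset_UNIV
        top.extremum_uniqueI)
  then have "x - y \<in> span (range h)"
    by simp
  then have "orthogonal (x - y) (x - y)"
    by (rule orthogonal_to_span) (use assms in \<open>auto simp: orthogonal_def inner_diff\<close>)
  then show ?thesis
    by (simp add: orthogonal_def)
qed

lemma expansion: "x = (\<Sum>i\<in>UNIV. (x \<bullet> h i / (h i \<bullet> h i)) *\<^sub>R h i)"
  by (rule inner_eqI) (use nonzero in simp)

lemma inner_self: "x \<bullet> x = (\<Sum>i\<in>UNIV. (x \<bullet> h i)\<^sup>2 / (h i \<bullet> h i))"
  by (subst (2) expansion) (simp add: inner_sum_right power2_eq_square)

end

text \<open>Each segment consists of its midpoint plus \<open>t *\<^sub>R h i\<close> with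
  \<open>\<bar>t\<bar> \<le> 1\<close>; by orthogonality, inner products read off the parameters
  separately.\<close>

lemma sum_closed_segments:
  fixes a b :: "'n::finite \<Rightarrow> real ^ 'n"
  defines "h \<equiv> \<lambda>i. (1 / 2) *\<^sub>R (b i - a i)" and "m \<equiv> \<Sum>i\<in>UNIV. (1 / 2) *\<^sub>R (a i + b i)"
  assumes "orthogonal_frame h"
  shows "(\<Sum>i\<in>UNIV. closed_segment (a i) (b i)) = {x. \<forall>i. \<bar>(x - m) \<bullet> h i\<bar> \<le> h i \<bullet> h i}"
proof -
  interpret orthogonal_frame h by fact
  have seg: "y \<in> closed_segment (a i) (b i)
      \<longleftrightarrow> (\<exists>t. \<bar>t\<bar> \<le> 1 \<and> y = (1 / 2) *\<^sub>R (a i + b i) + t *\<^sub>R h i)" (is "_ \<longleftrightarrow> ?r") for y i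
  proof
    assume "y \<in> closed_segment (a i) (b i)"
    then obtain u where u: "0 \<le> u" "u \<le> 1" and y: "y = (1 - u) *\<^sub>R a i + u *\<^sub>R b i"
      by (auto simp: in_segment)
    have "y = (1 / 2) *\<^sub>R (a i + b i) + (2 * u - 1) *\<^sub>R h i"
      unfolding y h_def by (simp add: vec_eq_iff field_simps)
    with u show ?r
      by (intro exI[of _ "2 * u - 1"]) auto
  next
    assume ?r
    then obtain t where t: "\<bar>t\<bar> \<le> 1" and y: "y = (1 / 2) *\<^sub>R (a i + b i) + t *\<^sub>R h i"
      by blast
    have "y = (1 - (1 + t) / 2) *\<^sub>R a i + ((1 + t) / 2) *\<^sub>R b i"
      unfolding y h_def by (simp add: vec_eq_iff field_simps)
    with t show "y \<in> closed_segment (a i) (b i)"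
      unfolding in_segment by (intro exI[of _ "(1 + t) / 2"]) auto
  qed
  show ?thesis
  proof (intro equalityI subsetI CollectI allI)
    fix x j assume "x \<in> (\<Sum>i\<in>UNIV. closed_segment (a i) (b i))"
    then obtain y where y: "x = sum y UNIV" "\<And>i. y i \<in> closed_segment (a i) (b i)"
      by (auto simp: set_sum_alt)
    then obtain t where t: "\<And>i. \<bar>t i\<bar> \<le> 1" "\<And>i. y i = (1 / 2) *\<^sub>R (a i + b i) + t i *\<^sub>R h i"
      unfolding seg by metis
    have "x - m = (\<Sum>i\<in>UNIV. t i *\<^sub>R h i)"
      by (simp add: y(1) t(2) m_def sum.distrib)
    then show "\<bar>(x - m) \<bullet> h j\<bar> \<le> h j \<bullet> h j"
      using t(1)[of j] by (simp add: abs_mult mult_left_le_one_le)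
  next
    fix x assume x: "x \<in> {x. \<forall>i. \<bar>(x - m) \<bullet> h i\<bar> \<le> h i \<bullet> h i}"
    define t where "t = (\<lambda>i. (x - m) \<bullet> h i / (h i \<bullet> h i))"
    have "\<bar>t i\<bar> \<le> 1" for i
      using x inner_pos[of i] by (simp add: t_def abs_divide)
    then have "\<forall>i\<in>UNIV. (1 / 2) *\<^sub>R (a i + b i) + t i *\<^sub>R h i \<in> closed_segment (a i) (b i)"
      using seg by blast
    moreover have "x = (\<Sum>i\<in>UNIV. (1 / 2) *\<^sub>R (a i + b i) + t i *\<^sub>R h i)"
      using expansion[of "x - m"] by (simp add: m_def sum.distrib t_def algebra_simps)
    ultimately show "x \<in> (\<Sum>i\<in>UNIV. closed_segment (a i) (b i))"
      unfolding set_sum_alt[OF finite_class.finite_UNIV] by blast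
  qed
qed

lemma rectangular_box_iff:
  "rectangular_box P \<longleftrightarrow>
    (\<exists>m h. orthogonal_frame h \<and> P = {x. \<forall>i. \<bar>(x - m) \<bullet> h i\<bar> \<le> h i \<bullet> h i})"
  for P :: "(real ^ 'n) set"
proof
  assume "rectangular_box P"
  then obtain a b :: "'n \<Rightarrow> real ^ 'n" where ab: "\<And>i. a i \<noteq> b i"
    "\<And>i j. i \<noteq> j \<Longrightarrow> orthogonal (b i - a i) (b j - a j)"
    "P = (\<Sum>i\<in>UNIV. closed_segment (a i) (b i))"
    unfolding rectangular_box_def by blast
  have "orthogonal_frame (\<lambda>i. (1 / 2) *\<^sub>R (b i - a i))"
    using ab(1,2) by unfold_locales (auto simp: orthogonal_def dest: sym)
  then show "\<exists>m h. orthogonal_frame h \<and> P = {x. \<forall>i. \<bar>(x - m) \<bullet> h i\<bar> \<le> h i \<bullet> h i}"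
    using sum_closed_segments[of b a] ab(3) by blast
next
  assume "\<exists>m h. orthogonal_frame h \<and> P = {x. \<forall>i. \<bar>(x - m) \<bullet> h i\<bar> \<le> h i \<bullet> h i}"
  then obtain m and h :: "'n \<Rightarrow> real ^ 'n" where h: "orthogonal_frame h"
    and P: "P = {x. \<forall>i. \<bar>(x - m) \<bullet> h i\<bar> \<le> h i \<bullet> h i}"
    by blast
  interpret orthogonal_frame h by fact
  \<comment> \<open>The centre is divided equally among the segments, so that their midpoints add up
    to \<open>m\<close>.\<close>
  define c where "c = (1 / real CARD('n)) *\<^sub>R m"
  have "(\<Sum>i\<in>(UNIV :: 'n set). c) = m"
    by (simp add: c_def sum_constant_scaleR del: sum_constant)
  then have "(\<Sum>i\<in>UNIV. closed_segment (c - h i) (c + h i)) = P"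
    using sum_closed_segments[of "\<lambda>i. c + h i" "\<lambda>i. c - h i"] h
    by (simp add: P scaleR_2[symmetric])
  moreover have diff: "(c + h i) - (c - h i) = 2 *\<^sub>R h i" for i
    by (simp add: scaleR_2)
  moreover have "c - h i \<noteq> c + h i" for i
    by (metis diff diff_self nonzero scaleR_eq_0_iff zero_neq_numeral)
  ultimately show "rectangular_box P"
    unfolding rectangular_box_def
    by (intro exI[of _ "\<lambda>i. c - h i"] exI[of _ "\<lambda>i. c + h i"])
      (simp add: orthogonal_def orth del: add_diff_cancel_left diff_diff_eq2)
qed

subsection \<open>Voronoi relevant vectors\<close>

context full_lattice
begin

text \<open>Voronoi's criterion for the facet vectors of the cell serves as the definition, which
  avoids the face structure of polytopes.\<close>

definition relevant :: "real ^ 'n \<Rightarrow> bool" where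
  "relevant v \<longleftrightarrow> v \<in> L \<and> v \<noteq> 0 \<and>
     (\<forall>w\<in>L. norm (v + 2 *\<^sub>R w) \<le> norm v \<longrightarrow> v + 2 *\<^sub>R w = v \<or> v + 2 *\<^sub>R w = - v)"

text \<open>Voronoi: if \<open>v' = v + 2 w\<close> is no longer than \<open>v\<close>, then \<open>a = (v + v') / 2\<close> and \<open>b = (v - v') / 2\<close> are
  lattice vectors, and the half-spaces of \<open>a\<close> and \<open>b\<close> imply that of \<open>v\<close>.\<close>

lemma not_relevant_split:
  assumes v: "v \<in> L" "v \<noteq> 0" and not_relevant: "\<not> relevant v"
  obtains a b where "a \<in> L" "b \<in> L" "v = a + b" "norm a < norm v" "norm b < norm v"
    "a \<bullet> a + b \<bullet> b \<le> v \<bullet> v"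
proof -
  obtain w where w: "w \<in> L" "norm (v + 2 *\<^sub>R w) \<le> norm v" "v + 2 *\<^sub>R w \<noteq> v" "v + 2 *\<^sub>R w \<noteq> - v"
    using v not_relevant by (auto simp: relevant_def)
  have "v + w \<noteq> 0"
  proof
    assume "v + w = 0"
    then have "w = - v"
      by (simp add: eq_neg_iff_add_eq_0 add.commute)
    then show False
      using w(4) by (simp add: scaleR_2)
  qed
  \<comment> \<open>Both parts are nonzero, so each is strictly shorter than \<open>v\<close> once
    their squared norms add up to at most that of \<open>v\<close>.\<close>
  then have pos: "(v + w) \<bullet> (v + w) > 0" "w \<bullet> w > 0"
    using w(3) by auto
  have "(v + 2 *\<^sub>R w) \<bullet> (v + 2 *\<^sub>R w) \<le> v \<bullet> v"
    using w(2) by (simp add: norm_le)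
  then have sum: "(v + w) \<bullet> (v + w) + w \<bullet> w \<le> v \<bullet> v"
    by (simp add: inner_add inner_commute)
  show thesis
    by (rule that[of "v + w" "- w"])
      (use v w(1) sum pos in \<open>auto simp: add_mem uminus_mem norm_lt simp del: inner_gt_zero_iff\<close>)
qed

text \<open>The descent in norm terminates because only finitely many lattice points are no longer
  than \<open>v\<close>; their number is the induction measure. The inequality in the last case is
  what makes half-space conditions additive.\<close>

lemma relevant_induct [consumes 1, case_names zero relevant add]:
  assumes "v \<in> L"
    and "Q 0"
    and "\<And>v. relevant v \<Longrightarrow> Q v"
    and "\<And>a b. Q a \<Longrightarrow> Q b \<Longrightarrow> a \<bullet> a + b \<bullet> b \<le> (a + b) \<bullet> (a + b) \<Longrightarrow> Q (a + b)"
  shows "Q v"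
  using assms(1)
proof (induction v rule: measure_induct_rule[where f = "\<lambda>v. card (L \<inter> cball 0 (norm v))"])
  case (less v)
  have smaller: "Q a" if "a \<in> L" "norm a < norm v" for a
  proof (rule less.IH)
    have "v \<in> L \<inter> cball 0 (norm v) - L \<inter> cball 0 (norm a)"
      using less.prems that by simp
    moreover have "L \<inter> cball 0 (norm a) \<subseteq> L \<inter> cball 0 (norm v)"
      using that(2) by auto
    ultimately show "card (L \<inter> cball 0 (norm a)) < card (L \<inter> cball 0 (norm v))"
      by (intro psubset_card_mono finite_lattice_cball) blast
  qed fact
  show ?case
  proof (cases "v = 0 \<or> relevant v")
    case True
    then show ?thesis
      using assms(2,3) by blast
  next
    case False
    then obtain a b where "a \<in> L" "b \<in> L" "v = a + b" "norm a < norm v" "norm b < norm v"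
      "a \<bullet> a + b \<bullet> b \<le> v \<bullet> v"
      using not_relevant_split[OF less.prems] by blast
    then show ?thesis
      using assms(4) smaller by blast
  qed
qed

lemma mem_cell_iff_relevant: "x \<in> cell \<longleftrightarrow> (\<forall>v. relevant v \<longrightarrow> 2 * (x \<bullet> v) \<le> v \<bullet> v)"
proof
  assume rel: "\<forall>v. relevant v \<longrightarrow> 2 * (x \<bullet> v) \<le> v \<bullet> v"
  have "2 * (x \<bullet> v) \<le> v \<bullet> v" if "v \<in> L" for v
    using that
  proof (induction v rule: relevant_induct)
    case (add a b)
    have "2 * (x \<bullet> (a + b)) \<le> a \<bullet> a + b \<bullet> b"
      using add(1,2) by (simp add: inner_add_right)
    with add(3) show ?case
      by linarith
  qed (use rel in auto)
  then show "x \<in> cell"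
    by (simp add: mem_cell_iff_inner)
qed (auto simp: mem_cell_iff_inner relevant_def)

lemma span_relevant: "span {v. relevant v} = UNIV"
proof -
  have "v \<in> span {v. relevant v}" if "v \<in> L" for v
    using that by (induction v rule: relevant_induct) (auto intro: span_add span_base span_zero)
  then show ?thesis
    using span_minimal[OF _ subspace_span, of L "{v. relevant v}"]
    by (auto simp: span_eq_UNIV)
qed

end

section \<open>Lattices with identically vanishing defect\<close>

locale zero_defect = full_lattice L for L :: "(real ^ 'n) set" +
  fixes p :: "real ^ 'n"
  assumes zero_defect: "defect p x = 0"
begin

text \<open>The shortest representatives of \<open>p\<close> modulo \<open>L\<close>, all of which
  lie in the cell. If \<open>p\<close> is at distance \<open>covering_radius L\<close>, they are the
  deep holes of the cell.\<close>

definition holes :: "(real ^ 'n) set" where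
  "holes = {s. s - p \<in> L \<and> norm s = infdist p L}"

lemma norm_ge_hole:
  assumes "y - p \<in> L"
  shows "infdist p L \<le> norm y"
  using infdist_le_norm_diff[OF uminus_mem[OF assms], of p] by simp

text \<open>Here \<open>p - x\<close> and \<open>x\<close> have the same distance up to sign and
  period, and \<open>2 *\<^sub>R x - p\<close> has distance 0, so the defect reduces to four times
  one square minus another.\<close>

lemma infdist_half:
  assumes "2 *\<^sub>R x - p \<in> L"
  shows "infdist x L = infdist p L / 2"
proof -
  have "infdist (p - x) L = infdist x L"
    using infdist_diff_lattice[OF assms, of x] by (simp add: scaleR_2)
  then have "4 * (infdist x L)\<^sup>2 = (infdist p L)\<^sup>2"
    using zero_defect[of x] assms by (simp add: defect_def)
  then have "(2 * infdist x L)\<^sup>2 = (infdist p L)\<^sup>2"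
    by (simp add: power_mult_distrib)
  then have "2 * infdist x L = infdist p L"
    by (rule power2_eq_imp_eq) (simp_all add: infdist_nonneg)
  then show ?thesis
    by simp
qed

lemma hole_exists: "\<exists>s. s \<in> holes"
proof -
  obtain v where "v \<in> L" "infdist p L = norm (p - v)"
    by (rule infdist_attained)
  then have "p - v \<in> holes"
    by (simp add: holes_def uminus_mem)
  then show ?thesis ..
qed

text \<open>The midpoint \<open>x\<close> of \<open>s\<close> and \<open>v\<close> has distance half
  that of \<open>p\<close>. A nearest lattice point \<open>u\<close> then yields a hole
  \<open>t\<close> congruent to \<open>s + v\<close> modulo \<open>2 L\<close>, and relevance of
  \<open>v\<close> leaves only two candidates.\<close>

lemma hole_shift:
  assumes s: "s \<in> holes" and v: "relevant v"
  shows "s + v \<in> holes \<or> s - v \<in> holes"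
proof -
  have vL: "v \<in> L" and sL: "s - p \<in> L" and norm_s: "norm s = infdist p L"
    using s v by (auto simp: holes_def relevant_def)
  define x where "x = (1 / 2) *\<^sub>R (s + v)"
  have "2 *\<^sub>R x - p = (s - p) + v"
    by (simp add: x_def)
  then have half: "infdist x L = infdist p L / 2"
    using add_mem[OF sL vL] by (intro infdist_half) (simp only:)
  obtain u where u: "u \<in> L" "infdist x L = norm (x - u)"
    by (rule infdist_attained)
  define t where "t = 2 *\<^sub>R (x - u)"
  have t: "t = s + v - 2 *\<^sub>R u"
    by (simp add: t_def x_def algebra_simps)
  have norm_t: "norm t = infdist p L"
    using half u(2) by (simp add: t_def)
  have tp: "t - p = (s - p) + v - u - u"
    by (simp add: t scaleR_2)
  then have tL: "t - p \<in> L"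
    unfolding tp by (intro add_mem diff_mem sL vL u(1))
  \<comment> \<open>Both points represent \<open>p\<close>, so neither is shorter than a hole.
    Adding the two squared inequalities compares \<open>t - s = v - 2 u\<close> with
    \<open>v\<close>.\<close>
  have "infdist p L \<le> norm (t + u)" "infdist p L \<le> norm (s - u)"
    using add_mem[OF tL u(1)] diff_mem[OF sL u(1)]
    by (auto intro!: norm_ge_hole simp: algebra_simps)
  then have "t \<bullet> t \<le> (t + u) \<bullet> (t + u)" "s \<bullet> s \<le> (s - u) \<bullet> (s - u)"
    using norm_t norm_s by (metis norm_le)+
  then have "(t - s) \<bullet> (t - s) \<le> (t - s + 2 *\<^sub>R u) \<bullet> (t - s + 2 *\<^sub>R u)"
    by (simp add: inner_add inner_diff inner_commute)
  then have "norm (v + 2 *\<^sub>R (- u)) \<le> norm v"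
    by (simp add: norm_le t)
  then have "v + 2 *\<^sub>R (- u) = v \<or> v + 2 *\<^sub>R (- u) = - v"
    using v uminus_mem[OF u(1)] unfolding relevant_def by blast
  then have "t = s + v \<or> t = s - v"
    by (auto simp: t)
  moreover have "t \<in> holes"
    using tL norm_t by (simp add: holes_def)
  ultimately show ?thesis
    by auto
qed

lemma hole_inner:
  assumes "s \<in> holes" "relevant v"
  shows "s + v \<in> holes \<and> 2 * (s \<bullet> v) = - (v \<bullet> v) \<or> s - v \<in> holes \<and> 2 * (s \<bullet> v) = v \<bullet> v"
proof -
  have eq: "2 * (s \<bullet> w) = - (w \<bullet> w)" if "s + w \<in> holes" for w
  proof -
    have "norm (s + w) = norm s"
      using assms(1) that by (simp add: holes_def)
    then show ?thesis
      by (simp add: norm_eq inner_add inner_commute)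
  qed
  show ?thesis
    using hole_shift[OF assms] eq[of v] eq[of "- v"] by auto
qed

text \<open>Both \<open>s\<close> and its neighbour \<open>s + v\<close> or \<open>s - v\<close> are
  holes, so each has inner product plus or minus half of \<open>w \<bullet> w\<close> with
  \<open>w\<close>. Their difference is \<open>v \<bullet> w\<close> up to sign.\<close>

lemma relevant_inner:
  assumes v: "relevant v" and w: "relevant w"
  shows "v \<bullet> w = 0 \<or> v \<bullet> w = w \<bullet> w \<or> v \<bullet> w = - (w \<bullet> w)"
proof -
  obtain s where s: "s \<in> holes"
    using hole_exists by blast
  consider "s + v \<in> holes" | "s - v \<in> holes"
    using hole_inner[OF s v] by blast
  then show ?thesis
  proof cases
    case 1
    then show ?thesis
      using hole_inner[OF 1 w] hole_inner[OF s w] by (auto simp: inner_add_left)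
  next
    case 2
    then show ?thesis
      using hole_inner[OF 2 w] hole_inner[OF s w] by (auto simp: inner_diff_left)
  qed
qed

text \<open>A nonzero inner product would equal both \<open>v \<bullet> v\<close> and
  \<open>w \<bullet> w\<close> up to sign, forcing \<open>v - w\<close> or \<open>v + w\<close> to
  vanish.\<close>

lemma relevant_orthogonal:
  assumes "relevant v" "relevant w" "v \<noteq> w" "v \<noteq> - w"
  shows "v \<bullet> w = 0"
proof (rule ccontr)
  assume ne: "v \<bullet> w \<noteq> 0"
  have pos: "v \<bullet> v > 0" "w \<bullet> w > 0" "(v - w) \<bullet> (v - w) > 0" "(v + w) \<bullet> (v + w) > 0"
    using assms by (auto simp: relevant_def eq_neg_iff_add_eq_0)
  show False
    using ne pos relevant_inner[OF assms(1,2)] relevant_inner[OF assms(2,1)]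
    by (auto simp: inner_add inner_diff inner_commute)
qed

text \<open>A basis of relevant vectors is orthogonal. Any relevant vector other than these and
  their negatives would be orthogonal to the whole basis, hence 0.\<close>

lemma rectangular_box_cell: "rectangular_box cell"
proof -
  obtain B where B: "B \<subseteq> {v. relevant v}" "independent B" "{v. relevant v} \<subseteq> span B"
    using maximal_independent_subset by blast
  have spanB: "span B = UNIV"
    using span_minimal[OF B(3) subspace_span] by (auto simp: span_relevant)
  have finB: "finite B"
    using B(2) by (rule independent_imp_finite)
  have "card B = CARD('n)"
    using dim_eq_card[of B UNIV] B(2) spanB by (simp add: dim_UNIV)
  then obtain h where h: "bij_betw h (UNIV :: 'n set) B"
    using finite_same_card_bij[of "UNIV :: 'n set" B] finB by auto
  have hB: "h i \<in> B" and rel: "relevant (h i)" for i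
    using bij_betwE[OF h] B(1) by auto
  have not_neg: "h i \<noteq> - h j" if "i \<noteq> j" for i j
  proof
    assume "h i = - h j"
    moreover have "h j \<in> B - {h i}"
      using h hB that by (auto simp: bij_betw_def inj_def)
    ultimately have "h i \<in> span (B - {h i})"
      by (metis span_base span_neg)
    then show False
      using B(2) hB dependent_def by blast
  qed
  have ne: "h i \<noteq> h j" if "i \<noteq> j" for i j
    using h that by (auto simp: bij_betw_def inj_def)
  \<comment> \<open>The bisector of 0 and \<open>h i\<close> passes through the midpoint, so half of
    each relevant vector is a half-axis.\<close>
  define g where "g = (\<lambda>i. (1 / 2) *\<^sub>R h i)"
  interpret orthogonal_frame g
  proof
    fix i show "g i \<noteq> 0"
      using rel[of i] by (simp add: g_def relevant_def)
  next
    fix i j :: 'n assume "i \<noteq> j"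
    then show "g i \<bullet> g j = 0"
      using relevant_orthogonal[OF rel rel ne not_neg] by (simp add: g_def)
  qed
  have all: "\<exists>i. v = h i \<or> v = - h i" if v: "relevant v" for v
  proof (rule ccontr)
    assume "\<not> ?thesis"
    then have "v \<bullet> g i = 0 \<bullet> g i" for i
      using relevant_orthogonal[OF v rel] by (simp add: g_def)
    then show False
      using inner_eqI v by (metis relevant_def)
  qed
  have "x \<in> cell \<longleftrightarrow> (\<forall>i. \<bar>(x - 0) \<bullet> g i\<bar> \<le> g i \<bullet> g i)" for x
  proof
    assume x: "x \<in> cell"
    show "\<forall>i. \<bar>(x - 0) \<bullet> g i\<bar> \<le> g i \<bullet> g i"
    proof
      fix i
      have "h i \<in> L" "- h i \<in> L"
        using rel[of i] uminus_mem by (auto simp: relevant_def)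
      then have "2 * (x \<bullet> h i) \<le> h i \<bullet> h i" "2 * (x \<bullet> (- h i)) \<le> (- h i) \<bullet> (- h i)"
        using x unfolding mem_cell_iff_inner by blast+
      then show "\<bar>(x - 0) \<bullet> g i\<bar> \<le> g i \<bullet> g i"
        by (simp add: g_def abs_le_iff)
    qed
  next
    assume x: "\<forall>i. \<bar>(x - 0) \<bullet> g i\<bar> \<le> g i \<bullet> g i"
    have bound: "2 * \<bar>x \<bullet> h i\<bar> \<le> h i \<bullet> h i" for i
      using spec[OF x, of i] by (simp add: g_def abs_mult)
    show "x \<in> cell"
      unfolding mem_cell_iff_relevant
    proof (intro allI impI)
      fix v assume "relevant v"
      then obtain i where "v = h i \<or> v = - h i"
        using all by blast
      then show "2 * (x \<bullet> v) \<le> v \<bullet> v"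
        using bound[of i] by auto
    qed
  qed
  then have "cell = {x. \<forall>i. \<bar>(x - 0) \<bullet> g i\<bar> \<le> g i \<bullet> g i}"
    by blast
  then show ?thesis
    unfolding rectangular_box_iff using orthogonal_frame_axioms by blast
qed

end

subsection \<open>Box-shaped Voronoi cells\<close>

locale box_lattice = full_lattice L + orthogonal_frame h
  for L :: "(real ^ 'n) set" and h :: "'n \<Rightarrow> real ^ 'n" +
  fixes m :: "real ^ 'n"
  assumes cell_eq: "cell = {x. \<forall>i. \<bar>(x - m) \<bullet> h i\<bar> \<le> h i \<bullet> h i}"
begin

text \<open>The cell is symmetric about 0. Reflecting the facet points \<open>m + h i\<close> and
  \<open>m - h i\<close> bounds \<open>m \<bullet> h i\<close> by 0 from both sides.\<close>

lemma centre_eq_0: "m = 0"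
proof (rule inner_eqI)
  fix i
  have "m + h i \<in> cell" "m - h i \<in> cell"
    by (auto simp: cell_eq abs_inner_le)
  then have "- (m + h i) \<in> cell" "- (m - h i) \<in> cell"
    by (auto simp only: uminus_mem_cell_iff)
  then have "\<bar>(- (m + h i) - m) \<bullet> h i\<bar> \<le> h i \<bullet> h i" "\<bar>(- (m - h i) - m) \<bullet> h i\<bar> \<le> h i \<bullet> h i"
    unfolding cell_eq by blast+
  then show "m \<bullet> h i = 0 \<bullet> h i"
    by (simp only: inner_diff_left inner_add_left inner_minus_left inner_zero_left abs_le_iff)
      linarith
qed

lemma mem_cell_box_iff: "x \<in> cell \<longleftrightarrow> (\<forall>i. \<bar>x \<bullet> h i\<bar> \<le> h i \<bullet> h i)"
  by (simp add: cell_eq centre_eq_0)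

lemma facet_vector_mem: "2 *\<^sub>R h i \<in> L"
proof -
  \<comment> \<open>Points just outside the facet through \<open>h i\<close> are closer to some nonzero lattice vector than to 0;
    in the limit \<open>h i\<close> is equidistant from 0 and such a vector, which must be \<open>2 h i\<close>.\<close>
  have le: "infdist ((1 + d) *\<^sub>R h i) (L - {0}) \<le> norm ((1 + d) *\<^sub>R h i)" if "d > 0" for d
  proof -
    have "(1 + d) *\<^sub>R h i \<notin> cell"
      using that inner_pos[of i] unfolding mem_cell_box_iff
      by (auto simp: abs_mult not_le intro!: exI[of _ i])
    then obtain v where v: "v \<in> L" "norm ((1 + d) *\<^sub>R h i - v) < norm ((1 + d) *\<^sub>R h i)"
      by (auto simp: mem_cell_iff not_le)
    then have "v \<in> L - {0}"
      by auto
    then show ?thesis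
      using v(2) infdist_le[of v "L - {0}" "(1 + d) *\<^sub>R h i"] by (simp add: dist_norm)
  qed
  have lims: "((\<lambda>d. infdist ((1 + d) *\<^sub>R h i) (L - {0})) \<longlongrightarrow> infdist ((1 + 0) *\<^sub>R h i) (L - {0})) (at_right 0)"
    "((\<lambda>d. norm ((1 + d) *\<^sub>R h i)) \<longlongrightarrow> norm ((1 + 0) *\<^sub>R h i)) (at_right 0)"
    by (intro tendsto_intros)+
  have "infdist ((1 + 0) *\<^sub>R h i) (L - {0}) \<le> norm ((1 + 0) *\<^sub>R h i)"
    by (rule tendsto_le[OF trivial_limit_at_right_real lims(2) lims(1)])
      (use le in \<open>auto intro: eventually_mono[OF eventually_at_right_less]\<close>)
  then have inf: "infdist (h i) (L - {0}) \<le> norm (h i)"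
    by simp
  have "closed (L - {0})"
    by (rule uniform_discrete_imp_closed[OF uniform_discrete_subset[OF uniform_discrete_lattice]]) auto
  moreover have "L - {0} \<noteq> {}"
  proof
    assume "L - {0} = {}"
    then have "L = {0}"
      using zero_mem by blast
    then have "h i \<in> span {0}"
      using span_eq_UNIV by simp
    then show False
      using nonzero by simp
  qed
  ultimately obtain v where v: "v \<in> L - {0}" "infdist (h i) (L - {0}) = dist (h i) v"
    using infdist_attains_inf by blast
  then have le: "v \<bullet> v \<le> 2 * (h i \<bullet> v)"
    using inf by (simp add: dist_norm norm_le inner_diff inner_commute)
  have cell: "2 * (x \<bullet> v) \<le> v \<bullet> v" if "x \<in> cell" for x
    using that v(1) by (auto simp: mem_cell_iff_inner)
  have "h i \<in> cell"
    by (simp add: mem_cell_box_iff abs_inner_le)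
  then have eq: "v \<bullet> v = 2 * (h i \<bullet> v)"
    using cell[of "h i"] le by simp
  \<comment> \<open>The functional \<open>x \<bullet> v\<close> is maximal on the cell at
    \<open>h i\<close>, yet \<open>h i + h j\<close> and \<open>h i - h j\<close> also lie in the
    cell.\<close>
  have perp: "h j \<bullet> v = 0" if "j \<noteq> i" for j
  proof -
    have "h i + h j \<in> cell" "h i - h j \<in> cell"
      unfolding mem_cell_box_iff inner_add_left inner_diff_left
      using that orth abs_inner_le[of i] abs_inner_le[of j]
      by (metis add.left_neutral add.right_neutral diff_zero diff_0 abs_minus_cancel)+
    then have "2 * ((h i + h j) \<bullet> v) \<le> v \<bullet> v" "2 * ((h i - h j) \<bullet> v) \<le> v \<bullet> v"
      by (auto intro: cell)
    then show ?thesis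
      by (simp add: eq inner_add_left inner_diff_left)
  qed
  define c where "c = (v \<bullet> h i) / (h i \<bullet> h i)"
  have v_eq: "v = c *\<^sub>R h i"
  proof (rule inner_eqI)
    fix j
    show "v \<bullet> h j = (c *\<^sub>R h i) \<bullet> h j"
      using perp[of j] nonzero[of i] by (cases "j = i") (auto simp: c_def orth inner_commute)
  qed
  then have "c * (c * (h i \<bullet> h i)) = 2 * (c * (h i \<bullet> h i))"
    using eq by simp
  moreover have "c \<noteq> 0"
    using v(1) v_eq by auto
  ultimately have "c = 2"
    using nonzero[of i] by simp
  then show ?thesis
    using v(1) v_eq by simp
qed

text \<open>The coefficient 1 makes \<open>sum_inner\<close> applicable.\<close>

definition corner :: "real ^ 'n" where
  "corner = (\<Sum>i\<in>UNIV. 1 *\<^sub>R h i)"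

lemma corner_mem_cell: "corner \<in> cell"
  by (simp only: mem_cell_box_iff corner_def sum_inner) simp

text \<open>The corner maximises every squared coordinate along the axes at once.\<close>

lemma norm_le_corner:
  assumes "x \<in> cell"
  shows "norm x \<le> norm corner"
proof -
  have "x \<bullet> x \<le> corner \<bullet> corner"
    unfolding inner_self[of x] inner_self[of corner]
  proof (intro sum_mono divide_right_mono)
    fix i
    have "\<bar>x \<bullet> h i\<bar> \<le> \<bar>corner \<bullet> h i\<bar>"
      using assms by (simp only: mem_cell_box_iff corner_def sum_inner) simp
    then show "(x \<bullet> h i)\<^sup>2 \<le> (corner \<bullet> h i)\<^sup>2"
      by (simp only: abs_le_square_iff)
  qed simp
  then show ?thesis
    by (simp add: norm_le)
qed

lemma infdist_corner: "infdist corner L = covering_radius L"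
proof -
  obtain p where "p \<in> cell" "norm p = covering_radius L"
    by (rule covering_radius_attained)
  then have "covering_radius L \<le> norm corner"
    using norm_le_corner by metis
  then show ?thesis
    using infdist_le_covering_radius[of corner] infdist_cell[OF corner_mem_cell] by simp
qed

lemma defect_corner: "defect corner x = 0"
proof -
  have "defect corner x = 0" if x: "x \<in> cell" for x
  proof -
    \<comment> \<open>The signs select the corner \<open>s\<close> in the orthant of
      \<open>x\<close>; a zero coordinate counts as positive.\<close>
    define sg where "sg = (\<lambda>i. if 0 \<le> x \<bullet> h i then 1 else -1 :: real)"
    define s where "s = (\<Sum>i\<in>UNIV. sg i *\<^sub>R h i)"
    have s_inner: "s \<bullet> h i = sg i * (h i \<bullet> h i)" for i
      by (simp add: s_def)
    have "corner - s = (\<Sum>i\<in>UNIV. (1 - sg i) *\<^sub>R h i)"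
      by (simp add: s_def corner_def sum_subtractf scaleR_diff_left)
    \<comment> \<open>The coefficients are 0 or 2, so only the facet vectors occur.\<close>
    also have "\<dots> \<in> L"
      by (rule sum_mem) (auto simp: sg_def facet_vector_mem)
    finally have cs: "corner - s \<in> L" .
    have xh: "\<bar>x \<bullet> h i\<bar> \<le> h i \<bullet> h i" for i
      using x by (simp add: mem_cell_box_iff)
    \<comment> \<open>Relative to \<open>sg i\<close>, the coordinate of \<open>x\<close> is some
      \<open>t\<close> between 0 and 1, so \<open>1 - t\<close> and \<open>2 t - 1\<close> stay
      between -1 and 1.\<close>
    have "s \<in> cell" "s - x \<in> cell" "2 *\<^sub>R x - s \<in> cell"
      unfolding mem_cell_box_iff inner_diff_left s_inner inner_scaleR_left
      using xh by (auto simp: sg_def abs_le_iff split: if_splits) (smt (verit) xh)+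
    then have norms: "infdist s L = norm s" "infdist (s - x) L = norm (s - x)"
      "infdist (2 *\<^sub>R x - s) L = norm (2 *\<^sub>R x - s)" "infdist x L = norm x"
      using x by (auto intro: infdist_cell)
    have "infdist corner L = infdist s L" "infdist (corner - x) L = infdist (s - x) L"
      "infdist (2 *\<^sub>R x - corner) L = infdist (2 *\<^sub>R x - s) L"
      using cs uminus_mem[OF cs] by (auto intro!: infdist_cong_lattice)
    then show ?thesis
      unfolding defect_def norms power2_norm_eq_inner
      by (simp add: norms power2_norm_eq_inner inner_diff inner_commute)
  qed
  moreover obtain v where "v \<in> L" "x - v \<in> cell"
    by (rule cell_reduction)
  ultimately show ?thesis
    using defect_add_lattice[of v corner "x - v"] by simp
qed

end

theorem theorem2:
  fixes \<Lambda> P :: "(real ^ 'n) set" and R :: real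
  assumes "full_rank_lattice \<Lambda>"
    and "P = voronoi_cell \<Lambda> 0"
    and "R = covering_radius \<Lambda>"
  shows "(LINT x:P|lebesgue. (norm x)\<^sup>2) = R\<^sup>2 / 3 * measure lebesgue P
           \<longleftrightarrow> rectangular_box P"
proof -
  interpret full_lattice \<Lambda>
    by unfold_locales fact
  show ?thesis
  proof
    assume eq: "(LINT x:P|lebesgue. (norm x)\<^sup>2) = R\<^sup>2 / 3 * measure lebesgue P"
    obtain p where p: "p \<in> cell" "norm p = R"
      using covering_radius_attained assms(3) by blast
    have "\<forall>x. defect p x = 0"
      using eq second_moment_eq_iff[of p R] p by (simp add: assms(2) infdist_cell)
    then interpret zero_defect \<Lambda> p
      by unfold_locales blast
    show "rectangular_box P"
      using rectangular_box_cell by (simp add: assms(2))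
  next
    assume "rectangular_box P"
    then obtain m h where h: "orthogonal_frame h"
      and P: "P = {x. \<forall>i. \<bar>(x - m) \<bullet> h i\<bar> \<le> h i \<bullet> h i}"
      unfolding rectangular_box_iff by blast
    interpret orthogonal_frame h by fact
    interpret box_lattice \<Lambda> h m
      using P assms(2) by unfold_locales simp
    show "(LINT x:P|lebesgue. (norm x)\<^sup>2) = R\<^sup>2 / 3 * measure lebesgue P"
      using second_moment_eq_iff[of corner R] defect_corner infdist_corner assms(2,3) by simp
  qed
qed

end
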